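(* Let $(C,\sqsubseteq)$ be a complete lattice, $b\colon C\to C$ a monotone map and $f\in C$. Let $[C\to C]$ be the complete lattice of monotone maps on $C$ ordered pointwise and $B\colon[C\to C]\to[C\to C]$ defined by $B(a)=\bigsqcup\{c\in[C\to C]\mid c\circ b\sqsubseteq b\circ a,\ c(f)\sqsubseteq f\}$. Then $\omega_{b,f}=\nu B$, the greatest fixed point of $B$.
   Context: A monotone map $a\colon C\to C$ is $(b,f)$-compatible iff $a(f)\sqsubseteq f$ and $a\circ b\sqsubseteq b\circ a$. The $f$-companion of $b$ is $\omega_{b,f}=\bigsqcup\{a\mid a \text{ monotone and }(b,f)\text{-compatible}\}$ (pointwise join). *)

theory Defs
  imports Main
begin

typedef (overloaded) 'a mono_map = "{a :: 'a::complete_lattice \<Rightarrow> 'a. mono a}"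
  morphisms app Mono_map
  by (rule exI[of _ id]) (simp add: mono_def)

setup_lifting type_definition_mono_map

instantiation mono_map :: (complete_lattice) complete_lattice
begin

lift_definition less_eq_mono_map :: "'a mono_map \<Rightarrow> 'a mono_map \<Rightarrow> bool"
  is "(\<le>)" .

lift_definition less_mono_map :: "'a mono_map \<Rightarrow> 'a mono_map \<Rightarrow> bool"
  is "(<)" .

lift_definition inf_mono_map :: "'a mono_map \<Rightarrow> 'a mono_map \<Rightarrow> 'a mono_map"
  is "\<lambda>a c x. inf (a x) (c x)"
  by (auto simp: mono_def intro: le_infI1 le_infI2)

lift_definition sup_mono_map :: "'a mono_map \<Rightarrow> 'a mono_map \<Rightarrow> 'a mono_map"
  is "\<lambda>a c x. sup (a x) (c x)"
  by (auto simp: mono_def intro: le_supI1 le_supI2)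

lift_definition bot_mono_map :: "'a mono_map" is "\<lambda>x. bot"
  by (simp add: mono_def)

lift_definition top_mono_map :: "'a mono_map" is "\<lambda>x. top"
  by (simp add: mono_def)

lift_definition Inf_mono_map :: "'a mono_map set \<Rightarrow> 'a mono_map"
  is "\<lambda>A x. INF a\<in>A. a x"
  by (rule monoI, rule INF_mono) (auto simp: mono_def)

lift_definition Sup_mono_map :: "'a mono_map set \<Rightarrow> 'a mono_map"
  is "\<lambda>A x. SUP a\<in>A. a x"
  by (rule monoI, rule SUP_mono) (auto simp: mono_def)

instance
  by standard
    (transfer; auto simp: le_fun_def less_fun_def less_le_not_le fun_eq_iff
       intro: order_trans antisym INF_lower SUP_upper INF_greatest SUP_least)+

end

definition compatible :: "('a::complete_lattice \<Rightarrow> 'a) \<Rightarrow> 'a \<Rightarrow> ('a \<Rightarrow> 'a) \<Rightarrow> bool"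
  where "compatible b f a \<longleftrightarrow> a f \<le> f \<and> a \<circ> b \<le> b \<circ> a"

definition companion :: "('a::complete_lattice \<Rightarrow> 'a) \<Rightarrow> 'a \<Rightarrow> ('a \<Rightarrow> 'a)"
  where "companion b f = (\<lambda>x. Sup {a x | a. mono a \<and> compatible b f a})"

definition companion_op ::
  "('a::complete_lattice \<Rightarrow> 'a) \<Rightarrow> 'a \<Rightarrow> 'a mono_map \<Rightarrow> 'a mono_map"
  where "companion_op b f a = Sup {c. app c \<circ> b \<le> b \<circ> app a \<and> app c f \<le> f}"

text \<open>Monotonicity makes \<open>gfp\<close>, which the library defines as the join of all
  post-fixed points, the actual greatest fixed point of \<open>companion_op b f\<close>.\<close>

lemma mono_companion_op:
  assumes "mono b"
  shows "mono (companion_op b f)"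
proof (rule monoI)
  fix a a' :: "'a mono_map"
  assume "a \<le> a'"
  then have "b \<circ> app a \<le> b \<circ> app a'"
    using assms by (simp add: less_eq_mono_map.rep_eq le_fun_def mono_def)
  then show "companion_op b f a \<le> companion_op b f a'"
    unfolding companion_op_def by (intro Sup_subset_mono) auto
qed

end

theory Submission
  imports Defs
begin

text \<open>The monotone compatible maps are exactly the post-fixed points of \<open>companion_op b f\<close>:
  joins of monotone maps are pointwise, so \<open>companion_op b f a\<close> is itself the largest \<open>c\<close> with
  \<open>c \<circ> b \<le> b \<circ> a\<close> and \<open>c f \<le> f\<close>. Both sides are thus the join of the same family.\<close>

lemma le_companion_op_iff:
  "c \<le> companion_op b f a \<longleftrightarrow> app c \<circ> b \<le> b \<circ> app a \<and> app c f \<le> f"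
proof
  assume "c \<le> companion_op b f a"
  then have le: "app c x \<le> (SUP d\<in>{d. app d \<circ> b \<le> b \<circ> app a \<and> app d f \<le> f}. app d x)" for x
    by (simp add: companion_op_def less_eq_mono_map.rep_eq Sup_mono_map.rep_eq le_fun_def image_image)
  \<comment> \<open>Every member of the family is bounded by \<open>b (app a x)\<close> at the point
    \<open>b x\<close>, and by \<open>f\<close> at \<open>f\<close>; hence so is the pointwise join,
    and with it \<open>c\<close>.\<close>
  have "app c (b x) \<le> b (app a x)" for x
    by (rule order_trans[OF le]) (auto intro!: SUP_least simp: le_fun_def)
  moreover have "app c f \<le> f"
    by (rule order_trans[OF le]) (auto intro!: SUP_least)
  ultimately show "app c \<circ> b \<le> b \<circ> app a \<and> app c f \<le> f"
    by (simp add: le_fun_def)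
next
  assume "app c \<circ> b \<le> b \<circ> app a \<and> app c f \<le> f"
  then show "c \<le> companion_op b f a"
    unfolding companion_op_def by (intro Sup_upper) simp
qed

lemma compatible_iff_post_fixed:
  "compatible b f (app a) \<longleftrightarrow> a \<le> companion_op b f a"
  by (auto simp: compatible_def le_companion_op_iff)

theorem theorem9p15:
  fixes b :: "'a::complete_lattice \<Rightarrow> 'a" and f :: 'a
  assumes "mono b"
  shows "companion b f = app (gfp (companion_op b f))"
proof
  fix x
  \<comment> \<open>A monotone \<open>a\<close> equals \<open>app (Mono_map a)\<close>, so
    \<open>app\<close> reaches every map in the family that defines
    \<open>companion\<close>.\<close>
  have "{a | a. mono a \<and> compatible b f a} = app ` {a. a \<le> companion_op b f a}"
    unfolding compatible_iff_post_fixed[symmetric]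
    using app by (auto simp: image_iff) (metis Mono_map_inverse mem_Collect_eq)
  then have "{a x | a. mono a \<and> compatible b f a} = (\<lambda>a. app a x) ` {a. a \<le> companion_op b f a}"
    by (auto simp: set_eq_iff image_iff)
  \<comment> \<open>\<open>gfp\<close> unfolds to the join of the post-fixed points, which is
    evaluated at \<open>x\<close> member by member.\<close>
  then show "companion b f x = app (gfp (companion_op b f)) x"
    by (simp add: companion_def gfp_def Sup_mono_map.rep_eq image_image)
qed

end
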